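(* (Monotonicity principle) Let $d=(d_0,\dots,d_n)$ and $e=(e_0,\dots,e_n)$ be degree sequences, and let $0\le i<n$ be such that $d_i=e_i$ and $d_{i+1}=e_{i+1}$, with these common values finite. If $d<e$, then $$\frac{\beta_{i,d_i}(\pi_d)}{\beta_{i+1,d_{i+1}}(\pi_d)}<\frac{\beta_{i,e_i}(\pi_e)}{\beta_{i+1,e_{i+1}}(\pi_e)} .$$
   Context: A degree sequence is $d=(d_0,\dots,d_n)\in(\mathbb Z\cup\{\infty\})^{n+1}$ with $d_i+1\le d_{i+1}$ for all $i$. The pure diagram $\pi_d$ is the array of rational numbers $\beta_{i,j}(\pi_d)$ ($0\le i\le n$, $j\in\mathbb Z$) defined by $\beta_{i,j}(\pi_d)=0$ if $j\ne d_i$, and $\beta_{i,d_i}(\pi_d)=\prod_{k\ne i,\ d_k<\infty}\frac{1}{|d_i-d_k|}$ if $d_i<\infty$. Degree sequences are ordered termwise: $d\le e$ means $d_i\le e_i$ for all $i$, and $d<e$ means $d\le e$ and $d\ne e$. *)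

theory Defs
  imports Complex_Main "HOL-Library.Extended"
begin

text \<open>
  The set of integers together with infinity is modelled inside \<^typ>\<open>int extended\<close>, where
  \<open>Fin a\<close> is the integer \<open>a\<close>; this type also has a least element \<open>-\<infinity>\<close>, which is excluded
  explicitly. A tuple \<open>(d\<^sub>0, \<dots>, d\<^sub>n)\<close> is a function on \<^typ>\<open>nat\<close> of which only the
  values at \<open>i \<le> n\<close> are ever used.
\<close>

definition degree_sequence :: "nat \<Rightarrow> (nat \<Rightarrow> int extended) \<Rightarrow> bool" where
  "degree_sequence n d \<longleftrightarrow> (\<forall>i\<le>n. d i \<noteq> -\<infinity>) \<and> (\<forall>i<n. d i + 1 \<le> d (i + 1))"

text \<open>The value at the infinite elements is irrelevant.\<close>

definition fin_part :: "int extended \<Rightarrow> int" where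
  "fin_part x = (case x of Fin a \<Rightarrow> a | _ \<Rightarrow> 0)"

text \<open>\<open>pure_diagram n d i j\<close> is the entry of the pure diagram of \<open>d\<close> in position \<open>(i, j)\<close>; it is
  set to zero outside the range \<open>i \<le> n\<close> of the array. If \<open>d i = \<infinity>\<close>, the whole row is zero.\<close>

definition pure_diagram :: "nat \<Rightarrow> (nat \<Rightarrow> int extended) \<Rightarrow> nat \<Rightarrow> int \<Rightarrow> rat" where
  "pure_diagram n d i j =
     (if i \<le> n \<and> d i = Fin j
      then \<Prod>k\<in>{k. k \<le> n \<and> k \<noteq> i \<and> d k < \<infinity>}.
             1 / of_int \<bar>fin_part (d i) - fin_part (d k)\<bar>
      else 0)"

definition degseq_le :: "nat \<Rightarrow> (nat \<Rightarrow> int extended) \<Rightarrow> (nat \<Rightarrow> int extended) \<Rightarrow> bool" where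
  "degseq_le n d e \<longleftrightarrow> (\<forall>i\<le>n. d i \<le> e i)"

text \<open>The second conjunct says that the tuples \<open>(d\<^sub>0, \<dots>, d\<^sub>n)\<close> and \<open>(e\<^sub>0, \<dots>, e\<^sub>n)\<close> differ.\<close>

definition degseq_less :: "nat \<Rightarrow> (nat \<Rightarrow> int extended) \<Rightarrow> (nat \<Rightarrow> int extended) \<Rightarrow> bool" where
  "degseq_less n d e \<longleftrightarrow> degseq_le n d e \<and> \<not> (\<forall>i\<le>n. d i = e i)"

end

theory Submission
  imports Defs
begin

text \<open>
  In the quotient the common factor \<open>1 / \<bar>d\<^sub>i - d\<^sub>i\<^sub>+\<^sub>1\<bar>\<close> cancels, which leaves the product of
  \<open>\<bar>d\<^sub>i\<^sub>+\<^sub>1 - d\<^sub>k\<bar> / \<bar>d\<^sub>i - d\<^sub>k\<bar>\<close> over \<open>k \<noteq> i, i + 1\<close>, where an infinite \<open>d\<^sub>k\<close> contributes its limit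
  value \<open>1\<close>. This factor is \<open>1 + (d\<^sub>i\<^sub>+\<^sub>1 - d\<^sub>i) / (d\<^sub>i - d\<^sub>k)\<close>, positive and strictly increasing in
  \<open>d\<^sub>k\<close> both below \<open>d\<^sub>i\<close> and above \<open>d\<^sub>i\<^sub>+\<^sub>1\<close>.
\<close>

definition ratio_factor :: "int \<Rightarrow> int \<Rightarrow> int extended \<Rightarrow> rat" where
  "ratio_factor a b x =
     (if x < \<infinity> then of_int \<bar>b - fin_part x\<bar> / of_int \<bar>a - fin_part x\<bar> else 1)"

lemma fin_part_Fin [simp]: "fin_part (Fin a) = a"
  by (simp add: fin_part_def)

text \<open>Once an entry is \<infinity>, all later ones are, so a finite entry forces finite
  entries before it; the increments of at least 1 make them strictly smaller.\<close>

lemma degree_sequence_finite_below: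
  assumes "degree_sequence n d" "j < k" "k \<le> n" "d k = Fin b"
  obtains a where "d j = Fin a" "a < b"
proof -
  have "\<exists>a. d j = Fin a \<and> a < b"
    using assms(2-)
  proof (induction k arbitrary: b)
    case (Suc k)
    have "k < n" using Suc.prems by simp
    then have "d k + 1 \<le> d (k + 1)" "d k \<noteq> -\<infinity>"
      using assms(1) unfolding degree_sequence_def by auto
    then have "d k + 1 \<le> Fin b" "d k \<noteq> -\<infinity>"
      using Suc.prems by auto
    then obtain c where c: "d k = Fin c" "c < b"
      by (cases "d k") (auto simp: one_extended_def)
    show ?case
    proof (cases "j = k")
      case False
      then show ?thesis using Suc.IH[of c] Suc.prems c by force
    qed (use c in auto)
  qed simp
  then show ?thesis using that by blast
qed

lemma pure_diagram_ratio:
  assumes "degree_sequence n d" "i < n" "d i = Fin a" "d (i + 1) = Fin b"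
  shows "pure_diagram n d i a / pure_diagram n d (i + 1) b =
    (\<Prod>k\<in>{..n} - {i, i + 1}. ratio_factor a b (d k))"
proof -
  define T where "T = {k \<in> {..n} - {i, i + 1}. d k < \<infinity>}"
  have [simp]: "finite T" "i \<notin> T" "Suc i \<notin> T" by (auto simp: T_def)
  have ab: "a < b"
    using degree_sequence_finite_below[of n d i "i + 1" b] assms by auto
  \<comment> \<open>Each product omits its own index but keeps the other one of the pair; the kept
    index yields the common factor 1 / (b - a).\<close>
  have sets: "{k. k \<le> n \<and> k \<noteq> i \<and> d k < \<infinity>} = insert (i + 1) T"
    "{k. k \<le> n \<and> k \<noteq> i + 1 \<and> d k < \<infinity>} = insert i T"
    using assms by (auto simp: T_def)
  have "pure_diagram n d i a =
      1 / of_int (b - a) * (\<Prod>k\<in>T. 1 / of_int \<bar>a - fin_part (d k)\<bar>)"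
    using assms ab unfolding pure_diagram_def sets by simp
  moreover have "pure_diagram n d (i + 1) b =
      1 / of_int (b - a) * (\<Prod>k\<in>T. 1 / of_int \<bar>b - fin_part (d k)\<bar>)"
    using assms ab unfolding pure_diagram_def sets by simp
  moreover have "(of_int (b - a) :: rat) \<noteq> 0" using ab by simp
  ultimately have "pure_diagram n d i a / pure_diagram n d (i + 1) b =
      (\<Prod>k\<in>T. 1 / of_int \<bar>a - fin_part (d k)\<bar>) / (\<Prod>k\<in>T. 1 / of_int \<bar>b - fin_part (d k)\<bar>)"
    by simp
  also have "\<dots> = (\<Prod>k\<in>T. of_int \<bar>b - fin_part (d k)\<bar> / of_int \<bar>a - fin_part (d k)\<bar>)"
    by (simp add: prod_dividef)
  \<comment> \<open>The indices with infinite entries return with factor 1, so that both sequences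
    get products over the same index set.\<close>
  also have "\<dots> = (\<Prod>k\<in>{..n} - {i, i + 1}. ratio_factor a b (d k))"
    unfolding T_def ratio_factor_def by (rule prod.inter_filter) simp
  finally show ?thesis .
qed

lemma ratio_factor_pos:
  assumes "x \<noteq> Fin a" "x \<noteq> Fin b" "x \<noteq> -\<infinity>"
  shows "0 < ratio_factor a b x"
  using assms by (cases x) (auto simp: ratio_factor_def)

lemma ratio_factor_strict_mono_below:
  assumes "a < b" "x < y" "y < Fin a" "x \<noteq> -\<infinity>"
  shows "ratio_factor a b x < ratio_factor a b y"
proof -
  obtain u v where "x = Fin u" "y = Fin v" "u < v" "v < a"
    using assms by (cases x; cases y) auto
  \<comment> \<open>After clearing the positive denominators, the two sides differ by (b - a) * (v -
    u).\<close>
  moreover have "(b - u) * (a - v) < (b - v) * (a - u)"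
    using mult_strict_left_mono[of u v "b - a"] assms(1) \<open>u < v\<close> by (simp add: algebra_simps)
  then have "(of_int ((b - u) * (a - v)) :: rat) < of_int ((b - v) * (a - u))"
    by (simp only: of_int_less_iff)
  ultimately show ?thesis
    using assms(1) by (simp add: ratio_factor_def divide_simps)
qed

lemma ratio_factor_strict_mono_above:
  assumes "a < b" "Fin b < x" "x < y"
  shows "ratio_factor a b x < ratio_factor a b y"
proof -
  obtain u where u: "x = Fin u" "b < u"
    using assms by (cases x; cases y) auto
  show ?thesis
  proof (cases y)
    case (Fin v)
    then have "u < v" using assms(3) u by simp
    \<comment> \<open>Both absolute values change sign above b, but the difference is again (b - a)
      * (v - u).\<close>
    then have "(u - b) * (v - a) < (v - b) * (u - a)"
      using mult_strict_left_mono[of u v "b - a"] assms(1) by (simp add: algebra_simps)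
    then have "(of_int ((u - b) * (v - a)) :: rat) < of_int ((v - b) * (u - a))"
      by (simp only: of_int_less_iff)
    then show ?thesis
      using assms(1) u Fin \<open>u < v\<close> by (simp add: ratio_factor_def divide_simps)
  \<comment> \<open>For \<open>y = \<infinity>\<close> the claim is (u - b) / (u - a) < 1, that is,
    a < b.\<close>
  qed (use assms u in \<open>auto simp: ratio_factor_def divide_simps\<close>)
qed

theorem theorem1p9:
  fixes n i :: nat and d e :: "nat \<Rightarrow> int extended"
  assumes "degree_sequence n d" and "degree_sequence n e"
    and "i < n"
    and "d i = e i" and "d (i + 1) = e (i + 1)"
    and "d i < \<infinity>" and "d (i + 1) < \<infinity>"
    and "degseq_less n d e"
  shows "pure_diagram n d i (fin_part (d i)) / pure_diagram n d (i + 1) (fin_part (d (i + 1)))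
       < pure_diagram n e i (fin_part (e i)) / pure_diagram n e (i + 1) (fin_part (e (i + 1)))"
proof -
  have not_minf: "f k \<noteq> -\<infinity>" if "degree_sequence n f" "k \<le> n" for f k
    using that by (auto simp: degree_sequence_def)
  obtain b where b: "d (i + 1) = Fin b" "e (i + 1) = Fin b"
    using not_minf[OF assms(1), of "i + 1"] assms(3,5,7) by (cases "d (i + 1)") auto
  obtain a where a: "d i = Fin a" "e i = Fin a" and ab: "a < b"
    using degree_sequence_finite_below[OF assms(1) _ _ b(1), of i] assms(3,4) by auto
  have below: "f k < Fin a" if "degree_sequence n f" "f i = Fin a" "k < i" for f k
    by (rule degree_sequence_finite_below[OF that(1,3) _ that(2)]) (use assms(3) in auto)
  have above: "Fin b < f k"
    if "degree_sequence n f" "f (i + 1) = Fin b" "i + 1 < k" "k \<le> n" for f k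
  proof (cases "f k")
    case (Fin c)
    then show ?thesis
      using degree_sequence_finite_below[OF that(1,3,4) Fin] that(2) by auto
  qed (use not_minf[OF that(1,4)] in auto)
  have pos: "0 < ratio_factor a b (d k)" if "k \<in> {..n} - {i, i + 1}" for k
  proof (rule ratio_factor_pos)
    have "d k < Fin a \<or> Fin b < d k"
      using that below[OF assms(1) a(1), of k] above[OF assms(1) b(1), of k] by force
    then show "d k \<noteq> Fin a" "d k \<noteq> Fin b" using ab by auto
  qed (use that assms(1) not_minf in auto)
  \<comment> \<open>The factor has a pole at a, so \<open>d k\<close> and \<open>e k\<close> must
    lie on the same side of it: for k < i the bound \<open>e k < Fin a\<close> controls both, for k
    > i + 1 the bound \<open>Fin b < d k\<close> does.\<close>
  have mono: "ratio_factor a b (d k) < ratio_factor a b (e k)"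
    if "k \<in> {..n} - {i, i + 1}" "d k < e k" for k
  proof (cases "k < i")
    case True
    then show ?thesis
      using ratio_factor_strict_mono_below[OF ab that(2)] below[OF assms(2) a(2)]
        not_minf[OF assms(1), of k] that(1)
      by auto
  next
    case False
    then show ?thesis
      using ratio_factor_strict_mono_above[OF ab _ that(2)] above[OF assms(1) b(1), of k] that(1)
      by force
  qed
  have le: "d k \<le> e k" if "k \<le> n" for k
    using assms(8) that by (auto simp: degseq_less_def degseq_le_def)
  \<comment> \<open>The sequences agree at i and i + 1, so a place where they differ indexes a
    factor of the product.\<close>
  obtain m where m: "m \<le> n" "d m \<noteq> e m"
    using assms(8) by (auto simp: degseq_less_def)
  then have m': "m \<in> {..n} - {i, i + 1}" "d m < e m"
    using assms(4,5) le[of m] by auto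
  have weak: "ratio_factor a b (d k) \<le> ratio_factor a b (e k)" if "k \<in> {..n} - {i, i + 1}" for k
    using mono[OF that] le[of k] that by (auto simp: le_less)
  \<comment> \<open>All factors are positive and none decreases, so the strict increase at
    \<open>m\<close> carries over to the product.\<close>
  have "(\<Prod>k\<in>{..n} - {i, i + 1}. ratio_factor a b (d k))
      < (\<Prod>k\<in>{..n} - {i, i + 1}. ratio_factor a b (e k))"
    using m' pos weak mono less_le_trans[OF pos weak]
    by (intro prod_mono_strict[of m]) (auto intro: less_imp_le)
  then show ?thesis
    using pure_diagram_ratio[OF assms(1,3) a(1) b(1)] pure_diagram_ratio[OF assms(2,3) a(2) b(2)]
    by (simp only: a b fin_part_Fin)
qed

end
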